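(* Homeo-topo-bisimulations preserve validity: if $M = \langle S, \sigma, v\rangle$ and $M' = \langle S', \sigma', v'\rangle$ are topological models, $\rightleftarrows_f \subseteq S \times S'$ is a homeo-topo-bisimulation based on a homeomorphism $f : S \to S'$, and $s \rightleftarrows_f s'$, then for every modal formula $\varphi$, $M, s \models \varphi$ if and only if $M', s' \models \varphi$.
   Context: A topological model is $\langle S, \sigma, v\rangle$ with $\sigma$ a topology on $S$ and $v$ a valuation of propositional variables; modal formulae are interpreted with Boolean connectives as usual, $\Box$ as topological interior and $\Diamond$ as topological closure. Given a homeomorphism $f$ from $\langle S,\sigma\rangle$ onto $\langle S',\sigma'\rangle$, a homeo-topo-bisimulation based on $f$ is a nonempty relation $\rightleftarrows_f \subseteq S \times S'$ such that whenever $s \rightleftarrows_f s'$: (Base) $s \in v(p)$ iff $s' \in v'(p)$ for every propositional variable $p$; (Forth) if $s \in U \in \sigma$ then $f(U) \in \sigma'$, $s' \in f(U)$, and for every $t' \in f(U)$ there is $t \in U$ with $t \rightleftarrows_f t'$; (Back) if $s' \in f(U) \in \sigma'$ then there is $U \in \sigma$ with $s \in U$ such that for every $t \in U$ there is $t' \in f(U)$ with $t \rightleftarrows_f t'$. *)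

theory Defs
  imports "HOL-Analysis.Analysis"
begin

datatype 'p fm =
    Var 'p
  | Falsum
  | Neg "'p fm"
  | Conj "'p fm" "'p fm"
  | Disj "'p fm" "'p fm"
  | Impl "'p fm" "'p fm"
  | Box "'p fm"
  | Dia "'p fm"

text \<open>A model \<open>\<langle>S, \<sigma>, v\<rangle>\<close> is given by an abstract topology \<open>X\<close>, carrying
  both \<open>S = topspace X\<close> and \<open>\<sigma> = {U. openin X U}\<close>, and a valuation \<open>v\<close>.\<close>

definition topo_model :: "'a topology \<Rightarrow> ('p \<Rightarrow> 'a set) \<Rightarrow> bool" where
  "topo_model X v \<longleftrightarrow> (\<forall>p. v p \<subseteq> topspace X)"

primrec truth_set :: "'a topology \<Rightarrow> ('p \<Rightarrow> 'a set) \<Rightarrow> 'p fm \<Rightarrow> 'a set" where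
  "truth_set X v (Var p) = v p"
| "truth_set X v Falsum = {}"
| "truth_set X v (Neg \<phi>) = topspace X - truth_set X v \<phi>"
| "truth_set X v (Conj \<phi> \<psi>) = truth_set X v \<phi> \<inter> truth_set X v \<psi>"
| "truth_set X v (Disj \<phi> \<psi>) = truth_set X v \<phi> \<union> truth_set X v \<psi>"
| "truth_set X v (Impl \<phi> \<psi>) = (topspace X - truth_set X v \<phi>) \<union> truth_set X v \<psi>"
| "truth_set X v (Box \<phi>) = X interior_of (truth_set X v \<phi>)"
| "truth_set X v (Dia \<phi>) = X closure_of (truth_set X v \<phi>)"

definition sat :: "'a topology \<Rightarrow> ('p \<Rightarrow> 'a set) \<Rightarrow> 'a \<Rightarrow> 'p fm \<Rightarrow> bool" where
  "sat X v s \<phi> \<longleftrightarrow> s \<in> truth_set X v \<phi>"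

definition base_cond ::
  "('p \<Rightarrow> 'a set) \<Rightarrow> ('p \<Rightarrow> 'b set) \<Rightarrow> 'a \<Rightarrow> 'b \<Rightarrow> bool" where
  "base_cond v v' s s' \<longleftrightarrow> (\<forall>p. s \<in> v p \<longleftrightarrow> s' \<in> v' p)"

definition forth_cond ::
  "'a topology \<Rightarrow> 'b topology \<Rightarrow> ('a \<Rightarrow> 'b) \<Rightarrow> ('a \<times> 'b) set \<Rightarrow> 'a \<Rightarrow> 'b \<Rightarrow> bool" where
  "forth_cond X X' f R s s' \<longleftrightarrow>
     (\<forall>U. s \<in> U \<and> openin X U \<longrightarrow>
        openin X' (f ` U) \<and> s' \<in> f ` U \<and> (\<forall>t'\<in>f ` U. \<exists>t\<in>U. (t, t') \<in> R))"

text \<open>In the back condition ``if \<open>s' \<in> f(U) \<in> \<sigma>'\<close> then there is \<open>U \<in> \<sigma>\<close> with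
  \<open>s \<in> U\<close> such that for every \<open>t \<in> U\<close> there is \<open>t' \<in> f(U)\<close> with \<open>t\<close> related to
  \<open>t'\<close>'' the letter \<open>U\<close> occurs both free, in the given open set \<open>f(U)\<close>, and
  existentially bound. Here the bound occurrence is \<open>W\<close>, while \<open>f(U)\<close> is the given
  open set throughout. Identifying \<open>W\<close> with \<open>U\<close> would be a stronger requirement,
  hence yield a narrower class of relations; see \<open>back_cond_same_set\<close> below.\<close>

definition back_cond ::
  "'a topology \<Rightarrow> 'b topology \<Rightarrow> ('a \<Rightarrow> 'b) \<Rightarrow> ('a \<times> 'b) set \<Rightarrow> 'a \<Rightarrow> 'b \<Rightarrow> bool" where
  "back_cond X X' f R s s' \<longleftrightarrow>
     (\<forall>U. U \<subseteq> topspace X \<and> s' \<in> f ` U \<and> openin X' (f ` U) \<longrightarrow>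
        (\<exists>W. openin X W \<and> s \<in> W \<and> (\<forall>t\<in>W. \<exists>t'\<in>f ` U. (t, t') \<in> R)))"

definition homeo_topo_bisim ::
  "'a topology \<Rightarrow> ('p \<Rightarrow> 'a set) \<Rightarrow> 'b topology \<Rightarrow> ('p \<Rightarrow> 'b set) \<Rightarrow>
     ('a \<Rightarrow> 'b) \<Rightarrow> ('a \<times> 'b) set \<Rightarrow> bool" where
  "homeo_topo_bisim X v X' v' f R \<longleftrightarrow>
     homeomorphic_map X X' f \<and>
     R \<subseteq> topspace X \<times> topspace X' \<and> R \<noteq> {} \<and>
     (\<forall>s s'. (s, s') \<in> R \<longrightarrow>
        base_cond v v' s s' \<and> forth_cond X X' f R s s' \<and> back_cond X X' f R s s')"

lemma back_cond_same_set:
  assumes "\<And>U. U \<subseteq> topspace X \<Longrightarrow> s' \<in> f ` U \<Longrightarrow> openin X' (f ` U) \<Longrightarrow>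
      openin X U \<and> s \<in> U \<and> (\<forall>t\<in>U. \<exists>t'\<in>f ` U. (t, t') \<in> R)"
  shows "back_cond X X' f R s s'"
  unfolding back_cond_def
proof (intro allI impI)
  fix U assume "U \<subseteq> topspace X \<and> s' \<in> f ` U \<and> openin X' (f ` U)"
  then have "openin X U \<and> s \<in> U \<and> (\<forall>t\<in>U. \<exists>t'\<in>f ` U. (t, t') \<in> R)"
    by (elim conjE) (rule assms)
  then show "\<exists>W. openin X W \<and> s \<in> W \<and> (\<forall>t\<in>W. \<exists>t'\<in>f ` U. (t, t') \<in> R)"
    by (rule exI)
qed

end

theory Submission
  imports Defs
begin

text \<open>Forth says that every open neighbourhood of \<open>s\<close> dominates an open neighbourhood of \<open>s'\<close>
  along the relation, and, because every open set of the target is the image of its preimage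
  under the surjection \<open>f\<close>, Back says the same with the two sides exchanged. Either property
  moves interiors in one direction and closures in the other.\<close>

text \<open>An open \<open>U\<close> inside \<open>A\<close> around \<open>s\<close> yields a
  neighbourhood \<open>V\<close> of \<open>s'\<close> in which each point is related to some point
  of \<open>U\<close>, so \<open>V\<close> lies in \<open>B\<close>. \<open>X\<close>,
  \<open>Y\<close> and \<open>R\<close> are arbitrary so that the converse relation can be used as
  well.\<close>

lemma interior_of_transfer:
  assumes "\<And>U. openin X U \<Longrightarrow> s \<in> U \<Longrightarrow>
      \<exists>V. openin Y V \<and> s' \<in> V \<and> (\<forall>t'\<in>V. \<exists>t\<in>U. (t, t') \<in> R)"
    and "s \<in> X interior_of A"
    and "\<And>t t'. (t, t') \<in> R \<Longrightarrow> t \<in> A \<Longrightarrow> t' \<in> B"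
  shows "s' \<in> Y interior_of B"
proof -
  obtain U where U: "openin X U" "s \<in> U" "U \<subseteq> A"
    using assms(2) by (auto simp: interior_of_def)
  with assms(1) obtain V where V: "openin Y V" "s' \<in> V" "\<forall>t'\<in>V. \<exists>t\<in>U. (t, t') \<in> R"
    by meson
  with U(3) assms(3) have "V \<subseteq> B"
    by blast
  with V show ?thesis
    by (auto simp: interior_of_def)
qed

text \<open>The same domination property moves closures the opposite way, from \<open>Y\<close> to
  \<open>X\<close>: the \<open>V\<close> obtained from a neighbourhood \<open>U\<close> of
  \<open>s\<close> meets \<open>B\<close>, and a partner in \<open>U\<close> of the common point
  lies in \<open>A\<close>. The premise \<open>s \<in> topspace X\<close> excludes points without
  open neighbourhoods.\<close>

lemma closure_of_transfer:
  assumes "\<And>U. openin X U \<Longrightarrow> s \<in> U \<Longrightarrow>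
      \<exists>V. openin Y V \<and> s' \<in> V \<and> (\<forall>t'\<in>V. \<exists>t\<in>U. (t, t') \<in> R)"
    and "s \<in> topspace X" and "s' \<in> Y closure_of B"
    and "\<And>t t'. (t, t') \<in> R \<Longrightarrow> t' \<in> B \<Longrightarrow> t \<in> A"
  shows "s \<in> X closure_of A"
  unfolding in_closure_of
proof (intro conjI allI impI)
  fix U assume "s \<in> U \<and> openin X U"
  with assms(1) obtain V where V: "openin Y V" "s' \<in> V" "\<forall>t'\<in>V. \<exists>t\<in>U. (t, t') \<in> R"
    by meson
  with assms(3) obtain t' where "t' \<in> B" "t' \<in> V"
    unfolding in_closure_of by blast
  with V(3) assms(4) show "\<exists>y. y \<in> A \<and> y \<in> U"
    by blast
qed (rule assms(2))

context
  fixes X :: "'a topology" and v :: "'p \<Rightarrow> 'a set"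
    and X' :: "'b topology" and v' :: "'p \<Rightarrow> 'b set"
    and f :: "'a \<Rightarrow> 'b" and R :: "('a \<times> 'b) set"
  assumes bisim: "homeo_topo_bisim X v X' v' f R"
begin

lemma homeo_topo_bisim_forth:
  assumes "(s, s') \<in> R" and "openin X U" and "s \<in> U"
  shows "\<exists>V. openin X' V \<and> s' \<in> V \<and> (\<forall>t'\<in>V. \<exists>t\<in>U. (t, t') \<in> R)"
proof -
  have "forth_cond X X' f R s s'"
    using bisim assms(1) by (simp add: homeo_topo_bisim_def)
  with assms(2,3) show ?thesis
    unfolding forth_cond_def by meson
qed

text \<open>Stated with \<open>R\<inverse>\<close> so that it fits the first premise of the transfer
  lemmas with the two spaces exchanged.\<close>

lemma homeo_topo_bisim_back:
  assumes "(s, s') \<in> R" and "openin X' V" and "s' \<in> V"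
  shows "\<exists>W. openin X W \<and> s \<in> W \<and> (\<forall>t\<in>W. \<exists>t'\<in>V. (t', t) \<in> R\<inverse>)"
proof -
  have bk: "back_cond X X' f R s s'" and "homeomorphic_map X X' f"
    using bisim assms(1) by (simp_all add: homeo_topo_bisim_def)
  then have "V \<subseteq> f ` topspace X"
    using openin_subset[OF assms(2)] by (simp add: homeomorphic_imp_surjective_map)
  then obtain U where "U \<subseteq> topspace X" "V = f ` U"
    by (auto simp: subset_image_iff)
  with bk assms(2,3) show ?thesis
    unfolding back_cond_def by auto
qed

lemma homeo_topo_bisim_truth_set:
  "(s, s') \<in> R \<Longrightarrow> s \<in> truth_set X v \<phi> \<longleftrightarrow> s' \<in> truth_set X' v' \<phi>"
\<comment> \<open>The points are generalized because the modal cases apply the induction hypothesis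
  to other related pairs.\<close>
proof (induction \<phi> arbitrary: s s')
  case (Var p)
  then show ?case
    using bisim by (auto simp: homeo_topo_bisim_def base_cond_def)
next
  case (Box \<phi>)
  show ?case
    unfolding truth_set.simps
  proof
    assume "s \<in> X interior_of truth_set X v \<phi>"
    with homeo_topo_bisim_forth[OF Box.prems] show "s' \<in> X' interior_of truth_set X' v' \<phi>"
      by (rule interior_of_transfer) (use Box.IH in auto)
  next
    assume "s' \<in> X' interior_of truth_set X' v' \<phi>"
    with homeo_topo_bisim_back[OF Box.prems] show "s \<in> X interior_of truth_set X v \<phi>"
      by (rule interior_of_transfer) (use Box.IH in auto)
  qed
next
  case (Dia \<phi>)
  have top: "s \<in> topspace X" "s' \<in> topspace X'"
    using bisim Dia.prems by (auto simp: homeo_topo_bisim_def)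
  show ?case
    unfolding truth_set.simps
  proof
    \<comment> \<open>In contrast to \<open>Box\<close>, Back serves the left-to-right direction
      here and Forth the converse.\<close>
    assume "s \<in> X closure_of truth_set X v \<phi>"
    with homeo_topo_bisim_back[OF Dia.prems] top(2)
    show "s' \<in> X' closure_of truth_set X' v' \<phi>"
      by (rule closure_of_transfer) (use Dia.IH in auto)
  next
    assume "s' \<in> X' closure_of truth_set X' v' \<phi>"
    with homeo_topo_bisim_forth[OF Dia.prems] top(1)
    show "s \<in> X closure_of truth_set X v \<phi>"
      by (rule closure_of_transfer) (use Dia.IH in auto)
  qed
\<comment> \<open>Complements are taken in the carriers, so negation and implication rely on
  \<open>R \<subseteq> topspace X \<times> topspace X'\<close>.\<close>
qed (use bisim in \<open>auto simp: homeo_topo_bisim_def\<close>)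

end

theorem theorem3p3:
  fixes X :: "'a topology" and v :: "'p \<Rightarrow> 'a set"
    and X' :: "'b topology" and v' :: "'p \<Rightarrow> 'b set"
    and f :: "'a \<Rightarrow> 'b" and R :: "('a \<times> 'b) set"
    and s :: 'a and s' :: 'b
  assumes "topo_model X v" and "topo_model X' v'"
    and "homeomorphic_map X X' f"
    and "homeo_topo_bisim X v X' v' f R"
    and "(s, s') \<in> R"
  shows "\<forall>\<phi> :: 'p fm. sat X v s \<phi> \<longleftrightarrow> sat X' v' s' \<phi>"
  using homeo_topo_bisim_truth_set[OF assms(4,5)] by (simp add: sat_def)

end
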